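(* Let $n\ge 2$ and let $\mathbf x\neq\mathbf y$ be bitstrings in $\{0,1\}^n$. The transposition gate $$T_{\mathbf x,\mathbf y}=|\mathbf x\rangle\langle\mathbf y|+|\mathbf y\rangle\langle\mathbf x|+\sum_{\mathbf w\ne\mathbf x,\mathbf y}|\mathbf w\rangle\langle\mathbf w|$$ on $n$ qubits can be realized exactly, without any ancilla qubit, by a circuit consisting of $\mathcal O(n)$ X and CX gates, arranged in depth $\mathcal O(\log n)$, together with a single multi-controlled X gate with $n-1$ controls.
   Context: A multi-controlled X gate with $n-1$ controls on $n$ qubits applies X to one designated target qubit if the other $n-1$ qubits are in a fixed computational basis state, and acts as the identity otherwise. CX gates may act between any two qubits. The depth $\mathcal O(\log n)$ refers to the X and CX gates (the part of the circuit other than the multi-controlled X gate). *)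

theory Defs
  imports "Jordan_Normal_Form.Matrix" "HOL-Library.Landau_Symbols" Complex_Main
begin

text \<open>An \<open>n\<close>-qubit operator is a complex \<open>2\<^sup>n \<times> 2\<^sup>n\<close> matrix. A bitstring is a \<open>bool list\<close> whose
  entry \<open>w ! q\<close> belongs to qubit \<open>q \<in> {0..<n}\<close>; qubit 0 is the most significant bit of the index
  of the basis vector \<open>|w\<rangle>\<close>.\<close>

definition bitstrings :: "nat \<Rightarrow> bool list set" where
  "bitstrings n = {w. length w = n}"

definition ket :: "bool list \<Rightarrow> complex vec" where
  "ket w = unit_vec (2 ^ length w) (horner_sum of_bool 2 (rev w))"

definition outer :: "complex vec \<Rightarrow> complex vec \<Rightarrow> complex mat" where
  "outer u v = mat (dim_vec u) (dim_vec v) (\<lambda>(i, j). u $ i * cnj (v $ j))"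

abbreviation ketbra :: "bool list \<Rightarrow> bool list \<Rightarrow> complex mat" where
  "ketbra u v \<equiv> outer (ket u) (ket v)"

text \<open>Matrix dimensions are not part of the type \<open>mat\<close>, so sums over a finite set are formed in the
  module of matrices of the given size.\<close>

abbreviation op_sum :: "nat \<Rightarrow> (bool list \<Rightarrow> complex mat) \<Rightarrow> bool list set \<Rightarrow> complex mat" where
  "op_sum n F A \<equiv> finsum (module_mat TYPE(complex) (2 ^ n) (2 ^ n)) F A"

definition transposition_gate :: "nat \<Rightarrow> bool list \<Rightarrow> bool list \<Rightarrow> complex mat" where
  "transposition_gate n x y =
     ketbra x y + ketbra y x + op_sum n (\<lambda>w. ketbra w w) (bitstrings n - {x, y})"

text \<open>In \<open>MCX c t\<close>, the domain of \<open>c\<close> is the set of control qubits, and \<open>c q = Some b\<close> means that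
  control \<open>q\<close> has to be in state \<open>|b\<rangle>\<close> for the target \<open>t\<close> to be flipped.\<close>

datatype gate =
    is_X: X nat
  | is_CX: CX nat nat
  | is_MCX: MCX "nat \<rightharpoonup> bool" nat

fun support :: "gate \<Rightarrow> nat set" where
  "support (X t) = {t}"
| "support (CX c t) = {c, t}"
| "support (MCX c t) = insert t (dom c)"

fun valid_gate :: "nat \<Rightarrow> gate \<Rightarrow> bool" where
  "valid_gate n (X t) \<longleftrightarrow> t < n"
| "valid_gate n (CX c t) \<longleftrightarrow> c < n \<and> t < n \<and> c \<noteq> t"
| "valid_gate n (MCX c t) \<longleftrightarrow> t < n \<and> dom c \<subseteq> {..<n} - {t} \<and> card (dom c) = n - 1"

abbreviation flip :: "nat \<Rightarrow> bool list \<Rightarrow> bool list" where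
  "flip t w \<equiv> w[t := \<not> w ! t]"

fun gate_action :: "gate \<Rightarrow> bool list \<Rightarrow> bool list" where
  "gate_action (X t) w = flip t w"
| "gate_action (CX c t) w = (if w ! c then flip t w else w)"
| "gate_action (MCX c t) w = (if \<forall>q\<in>dom c. c q = Some (w ! q) then flip t w else w)"

definition gate_mat :: "nat \<Rightarrow> gate \<Rightarrow> complex mat" where
  "gate_mat n g = op_sum n (\<lambda>w. ketbra (gate_action g w) w) (bitstrings n)"

text \<open>A circuit is a list of layers; gates in the same layer act on disjoint sets of qubits.
  The first gate of the list is applied first, i.e. it is the rightmost matrix factor.\<close>

type_synonym circuit = "gate list list"

definition valid_circuit :: "nat \<Rightarrow> circuit \<Rightarrow> bool" where
  "valid_circuit n C \<longleftrightarrow>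
     (\<forall>L\<in>set C. (\<forall>g\<in>set L. valid_gate n g) \<and>
                 sorted_wrt (\<lambda>g h. disjnt (support g) (support h)) L)"

fun gates_mat :: "nat \<Rightarrow> gate list \<Rightarrow> complex mat" where
  "gates_mat n [] = 1\<^sub>m (2 ^ n)"
| "gates_mat n (g # gs) = gates_mat n gs * gate_mat n g"

definition circuit_mat :: "nat \<Rightarrow> circuit \<Rightarrow> complex mat" where
  "circuit_mat n C = gates_mat n (concat C)"

definition mcx_count :: "circuit \<Rightarrow> nat" where
  "mcx_count C = length (filter is_MCX (concat C))"

definition x_cx_count :: "circuit \<Rightarrow> nat" where
  "x_cx_count C = length (filter (\<lambda>g. is_X g \<or> is_CX g) (concat C))"

definition x_cx_depth :: "circuit \<Rightarrow> nat" where
  "x_cx_depth C = length (filter (\<lambda>L. \<exists>g\<in>set L. is_X g \<or> is_CX g) C)"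

end

theory Submission
  imports Defs "HOL-Combinatorics.Transposition"
begin

text \<open>A multi-controlled X gate swaps two bitstrings that differ only at its target. If \<open>x\<close> and \<open>y\<close>
  differ exactly at the positions in \<open>D\<close>, a CX gate from \<open>a \<in> D\<close> to \<open>b \<in> D\<close> makes them agree at \<open>b\<close>.
  Pairing up half of the elements of \<open>D\<close> with another half, one layer of CX gates halves \<open>D\<close>, so
  logarithmically many layers leave a single differing position. Conjugating the multi-controlled X gate
  with these layers gives the transposition of \<open>x\<close> and \<open>y\<close>. No X gate is needed, because the control
  pattern is arbitrary.\<close>

section \<open>Permutation matrices on the computational basis\<close>

lemma finite_bitstrings [simp]: "finite (bitstrings n)"
  using finite_lists_length_eq[of "UNIV :: bool set" n] by (simp add: bitstrings_def)

lemma card_bitstrings: "card (bitstrings n) = 2 ^ n"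
  using card_lists_length_eq[of "UNIV :: bool set" n] by (simp add: bitstrings_def)

text \<open>The index inside \<open>ket\<close>, separated from the dimension so that it can serve
  as a bijection onto the row and column indices.\<close>

definition basis_index :: "bool list \<Rightarrow> nat" where
  "basis_index w = horner_sum of_bool 2 (rev w)"

lemma bij_betw_basis_index: "bij_betw basis_index (bitstrings n) {..<2 ^ n}"
proof -
  have inj: "inj_on basis_index (bitstrings n)"
  proof (rule inj_onI)
    fix v w assume v: "v \<in> bitstrings n" and w: "w \<in> bitstrings n"
      and eq: "basis_index v = basis_index w"
    have "rev v = rev w"
    proof (rule nth_equalityI)
      show "length (rev v) = length (rev w)" using v w by (simp add: bitstrings_def)
      \<comment> \<open>Bit \<open>i\<close> of the index is entry \<open>i\<close> of the reversed
        string, so the index determines the string.\<close>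
      fix i assume "i < length (rev v)"
      then show "rev v ! i = rev w ! i"
        using v w arg_cong[OF eq, of "\<lambda>k. bit k i"]
        by (simp add: basis_index_def bit_horner_sum_bit_iff bitstrings_def)
    qed
    then show "v = w" by simp
  qed
  moreover have "basis_index ` bitstrings n \<subseteq> {..<2 ^ n}"
    using horner_sum_of_bool_2_less[of "rev w" for w]
    by (auto simp: basis_index_def bitstrings_def)
  moreover have "card (basis_index ` bitstrings n) = card {..<(2::nat) ^ n}"
    using card_image[OF inj] by (simp add: card_bitstrings)
  ultimately show ?thesis
    by (simp add: bij_betw_def card_subset_eq)
qed

lemma ket_eq: "w \<in> bitstrings n \<Longrightarrow> ket w = unit_vec (2 ^ n) (basis_index w)"
  by (simp add: ket_def basis_index_def bitstrings_def)

lemma basis_index_less: "w \<in> bitstrings n \<Longrightarrow> basis_index w < 2 ^ n"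
  using bij_betw_basis_index[of n] by (auto simp: bij_betw_def)

lemma ketbra_carrier:
  "v \<in> bitstrings n \<Longrightarrow> w \<in> bitstrings n \<Longrightarrow> ketbra v w \<in> carrier_mat (2 ^ n) (2 ^ n)"
  by (simp add: outer_def ket_eq)

text \<open>Both claims go through one induction: reading an entry of
  \<open>F a + op_sum n F A\<close> requires the dimensions of the partial sum.\<close>

lemma op_sum_carrier_index:
  assumes "finite A" "\<And>w. w \<in> A \<Longrightarrow> F w \<in> carrier_mat (2 ^ n) (2 ^ n)"
  shows "op_sum n F A \<in> carrier_mat (2 ^ n) (2 ^ n) \<and>
    (\<forall>i<2 ^ n. \<forall>j<2 ^ n. op_sum n F A $$ (i, j) = (\<Sum>w\<in>A. F w $$ (i, j)))"
  using assms
proof (induction A rule: finite_induct)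
  case empty
  interpret abelian_group "module_mat TYPE(complex) (2 ^ n) (2 ^ n)" by (rule abelian_group_mat)
  show ?case by (simp add: module_mat_simps)
next
  case (insert a A)
  interpret abelian_group "module_mat TYPE(complex) (2 ^ n) (2 ^ n)" by (rule abelian_group_mat)
  have "op_sum n F (insert a A) = F a + op_sum n F A"
    using insert finsum_insert[of A a F] by (auto simp: module_mat_simps)
  with insert show ?case by auto
qed

lemmas op_sum_carrier = op_sum_carrier_index[THEN conjunct1]
lemmas op_sum_index = op_sum_carrier_index[THEN conjunct2, rule_format]

text \<open>Common form for gates and the transposition: \<open>gate_mat n g\<close> is the instance
  for \<open>gate_action g\<close>. Allowing any map \<open>f\<close> avoids having to show first
  that gates permute the bitstrings.\<close>

definition basis_map_mat :: "nat \<Rightarrow> (bool list \<Rightarrow> bool list) \<Rightarrow> complex mat" where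
  "basis_map_mat n f = op_sum n (\<lambda>w. ketbra (f w) w) (bitstrings n)"

lemma basis_map_mat_carrier:
  "f \<in> bitstrings n \<rightarrow> bitstrings n \<Longrightarrow> basis_map_mat n f \<in> carrier_mat (2 ^ n) (2 ^ n)"
  unfolding basis_map_mat_def by (rule op_sum_carrier) (auto intro: ketbra_carrier)

lemma mult_mat_ket:
  fixes A :: "complex mat"
  assumes "A \<in> carrier_mat (2 ^ n) (2 ^ n)" "w \<in> bitstrings n"
  shows "A *\<^sub>v ket w = col A (basis_index w)"
proof -
  have "A *\<^sub>v ket w = A *\<^sub>v col (1\<^sub>m (2 ^ n)) (basis_index w)"
    using assms by (simp add: ket_eq basis_index_less)
  also have "\<dots> = col (A * 1\<^sub>m (2 ^ n)) (basis_index w)"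
    using assms by (intro col_mult2[symmetric]) (auto simp: basis_index_less)
  finally show ?thesis using assms by simp
qed

text \<open>By the index bijection the kets are all the unit vectors, so the products with kets are
  all the columns.\<close>

lemma mat_eq_by_kets:
  fixes A B :: "complex mat"
  assumes A: "A \<in> carrier_mat (2 ^ n) (2 ^ n)" and B: "B \<in> carrier_mat (2 ^ n) (2 ^ n)"
    and eq: "\<And>w. w \<in> bitstrings n \<Longrightarrow> A *\<^sub>v ket w = B *\<^sub>v ket w"
  shows "A = B"
proof (rule mat_col_eqI)
  fix i assume "i < dim_col B"
  then have "i \<in> basis_index ` bitstrings n"
    using B bij_betw_imp_surj_on[OF bij_betw_basis_index[of n]] by simp
  then obtain w where w: "w \<in> bitstrings n" "i = basis_index w" by blast
  then show "col A i = col B i"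
    using eq[OF w(1)] mult_mat_ket[OF A w(1)] mult_mat_ket[OF B w(1)] by simp
qed (use A B in auto)

lemma basis_map_mat_ket:
  assumes f: "f \<in> bitstrings n \<rightarrow> bitstrings n" and w: "w \<in> bitstrings n"
  shows "basis_map_mat n f *\<^sub>v ket w = ket (f w)"
proof (rule eq_vecI)
  note carr = basis_map_mat_carrier[OF f]
  have fw: "f w \<in> bitstrings n" using f w by auto
  show "dim_vec (basis_map_mat n f *\<^sub>v ket w) = dim_vec (ket (f w))"
    using carr by (simp add: ket_eq[OF fw])
  fix i assume "i < dim_vec (ket (f w))"
  then have i: "i < 2 ^ n" by (simp add: ket_eq[OF fw])
  have "(basis_map_mat n f *\<^sub>v ket w) $ i = basis_map_mat n f $$ (i, basis_index w)"
    using carr i w by (simp add: mult_mat_ket basis_index_less)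
  also have "\<dots> = (\<Sum>v\<in>bitstrings n. ketbra (f v) v $$ (i, basis_index w))"
    unfolding basis_map_mat_def using f i w
    by (intro op_sum_index) (auto intro: ketbra_carrier basis_index_less)
  \<comment> \<open>Orthonormality of the kets: the bra of \<open>v\<close> has a nonzero entry at
    the index of \<open>w\<close> only if \<open>v = w\<close>.\<close>
  also have "\<dots> = (\<Sum>v\<in>bitstrings n. if v = w then ket (f v) $ i else 0)"
  proof (rule sum.cong)
    fix v assume v: "v \<in> bitstrings n"
    then have fv: "f v \<in> bitstrings n" using f by auto
    have index_eq: "basis_index v = basis_index w \<longleftrightarrow> v = w"
      using bij_betw_basis_index[of n] v w by (auto simp: bij_betw_def inj_on_def)
    have "dim_vec (ket (f v)) = 2 ^ n" by (simp add: ket_eq[OF fv])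
    with index_eq show "ketbra (f v) v $$ (i, basis_index w) = (if v = w then ket (f v) $ i else 0)"
      using i basis_index_less[OF w] basis_index_less[OF v]
      by (cases "v = w") (simp_all add: outer_def ket_eq[OF v] ket_eq[OF w])
  qed simp
  finally show "(basis_map_mat n f *\<^sub>v ket w) $ i = ket (f w) $ i"
    using w by simp
qed

lemma transposition_gate_eq_basis_map_mat:
  assumes x: "x \<in> bitstrings n" and y: "y \<in> bitstrings n" and ne: "x \<noteq> y"
  shows "transposition_gate n x y = basis_map_mat n (transpose x y)"
proof -
  let ?R = "bitstrings n - {x, y}" and ?f = "transpose x y"
  have f: "?f \<in> bitstrings n \<rightarrow> bitstrings n" using x y by (auto simp: transpose_def)
  have R: "op_sum n (\<lambda>w. ketbra w w) ?R \<in> carrier_mat (2 ^ n) (2 ^ n)"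
    by (rule op_sum_carrier) (auto intro: ketbra_carrier)
  have split: "bitstrings n = insert x (insert y ?R)" using x y by auto
  show ?thesis
  proof (rule eq_matI)
    show "dim_row (transposition_gate n x y) = dim_row (basis_map_mat n ?f)"
      "dim_col (transposition_gate n x y) = dim_col (basis_map_mat n ?f)"
      using R basis_map_mat_carrier[OF f] by (auto simp: transposition_gate_def)
    fix i j assume "i < dim_row (basis_map_mat n ?f)" "j < dim_col (basis_map_mat n ?f)"
    then have ij: "i < 2 ^ n" "j < 2 ^ n" using basis_map_mat_carrier[OF f] by auto
    have "basis_map_mat n ?f $$ (i, j) = (\<Sum>w\<in>bitstrings n. ketbra (?f w) w $$ (i, j))"
      unfolding basis_map_mat_def using f ij by (intro op_sum_index) (auto intro: ketbra_carrier)
    \<comment> \<open>\<open>transpose x y\<close> exchanges \<open>x\<close> and \<open>y\<close>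
      and fixes the rest, so splitting off these two terms leaves the diagonal sum of
      \<open>transposition_gate\<close>.\<close>
    also have "\<dots> = ketbra y x $$ (i, j) + (ketbra x y $$ (i, j) + (\<Sum>w\<in>?R. ketbra (?f w) w $$ (i, j)))"
      by (subst split, subst sum.insert) (use ne in auto)
    also have "(\<Sum>w\<in>?R. ketbra (?f w) w $$ (i, j)) = (\<Sum>w\<in>?R. ketbra w w $$ (i, j))"
      by (intro sum.cong) auto
    also have "\<dots> = op_sum n (\<lambda>w. ketbra w w) ?R $$ (i, j)"
      using ij by (intro op_sum_index[symmetric]) (auto intro: ketbra_carrier)
    finally show "transposition_gate n x y $$ (i, j) = basis_map_mat n ?f $$ (i, j)"
      using R ij ketbra_carrier[OF x y] ketbra_carrier[OF y x] by (simp add: transposition_gate_def)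
  qed
qed

section \<open>Circuits as maps on bitstrings\<close>

lemma length_gate_action [simp]: "length (gate_action g w) = length w"
  by (cases g) auto

text \<open>The first gate is the rightmost factor and hence hits the ket first, matching the order
  of \<open>fold\<close>. The carrier claim is carried along because associativity of the
  matrix-vector product needs it.\<close>

lemma gates_mat_ket:
  "gates_mat n gs \<in> carrier_mat (2 ^ n) (2 ^ n) \<and>
    (\<forall>w\<in>bitstrings n. gates_mat n gs *\<^sub>v ket w = ket (fold gate_action gs w))"
proof (induction gs)
  case Nil
  then show ?case by (auto simp: ket_eq)
next
  case (Cons g gs)
  have g: "gate_action g \<in> bitstrings n \<rightarrow> bitstrings n" by (auto simp: bitstrings_def)
  have eq: "gate_mat n g = basis_map_mat n (gate_action g)"
    by (simp add: gate_mat_def basis_map_mat_def)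
  have "gate_mat n g \<in> carrier_mat (2 ^ n) (2 ^ n)"
    using basis_map_mat_carrier[OF g] by (simp add: eq)
  moreover have "gate_mat n g *\<^sub>v ket w = ket (gate_action g w)" if "w \<in> bitstrings n" for w
    using basis_map_mat_ket[OF g that] by (simp add: eq)
  moreover have "ket w \<in> carrier_vec (2 ^ n)" if "w \<in> bitstrings n" for w
    using that by (simp add: ket_eq)
  ultimately show ?case using Cons.IH g by (auto simp: assoc_mult_mat_vec[of _ "2 ^ n" "2 ^ n"])
qed

text \<open>From here on only the classical action on bitstrings has to be studied.\<close>

lemma circuit_mat_eq_transposition_gate:
  assumes xy: "x \<in> bitstrings n" "y \<in> bitstrings n" "x \<noteq> y"
    and act: "\<And>w. w \<in> bitstrings n \<Longrightarrow> fold gate_action (concat C) w = transpose x y w"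
  shows "circuit_mat n C = transposition_gate n x y"
proof -
  have f: "transpose x y \<in> bitstrings n \<rightarrow> bitstrings n" using xy by (auto simp: transpose_def)
  show ?thesis
    unfolding transposition_gate_eq_basis_map_mat[OF xy] circuit_mat_def
    by (rule mat_eq_by_kets)
      (use gates_mat_ket[of n "concat C"] basis_map_mat_carrier[OF f] basis_map_mat_ket[OF f] act
        in auto)
qed

section \<open>Halving the set of differing positions\<close>

definition diff_positions :: "bool list \<Rightarrow> bool list \<Rightarrow> nat set" where
  "diff_positions x y = {i. i < length x \<and> x ! i \<noteq> y ! i}"

text \<open>Since \<open>x\<close> and \<open>y\<close> differ at the control \<open>a\<close>, the
  gate fires on exactly one of them and so cancels their difference at \<open>b\<close>.\<close>

lemma diff_positions_CX:
  assumes "length x = length y" "a \<in> diff_positions x y" "b \<in> diff_positions x y" "a \<noteq> b"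
  shows "diff_positions (gate_action (CX a b) x) (gate_action (CX a b) y) = diff_positions x y - {b}"
  using assms by (auto simp: diff_positions_def nth_list_update)

lemma length_fold_gate_action [simp]: "length (fold gate_action gs w) = length w"
  by (induction gs arbitrary: w) auto

abbreviation cx_layer :: "(nat \<times> nat) list \<Rightarrow> gate list" where
  "cx_layer \<equiv> map (\<lambda>(a, b). CX a b)"

text \<open>As no position occurs twice among the pairs, removing one target leaves all later pairs
  inside the set of differing positions.\<close>

lemma diff_positions_cx_layer:
  assumes "length x = length y" "distinct (map fst ps @ map snd ps)"
    "set (map fst ps @ map snd ps) \<subseteq> diff_positions x y"
  shows "diff_positions (fold gate_action (cx_layer ps) x) (fold gate_action (cx_layer ps) y)
    = diff_positions x y - set (map snd ps)"
  using assms
proof (induction ps arbitrary: x y)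
  case Nil
  then show ?case by simp
next
  case (Cons p ps)
  obtain a b where p: "p = (a, b)" by fastforce
  let ?g = "gate_action (CX a b)"
  have d: "diff_positions (?g x) (?g y) = diff_positions x y - {b}"
    by (rule diff_positions_CX) (use Cons.prems p in auto)
  have "diff_positions (fold gate_action (cx_layer ps) (?g x)) (fold gate_action (cx_layer ps) (?g y))
      = diff_positions (?g x) (?g y) - set (map snd ps)"
    by (rule Cons.IH) (use Cons.prems p d in auto)
  then show ?case unfolding d by (auto simp: p)
qed

section \<open>Inverses and conjugation by a layer\<close>

lemma gate_action_involutive:
  "valid_gate (length w) g \<Longrightarrow> gate_action g (gate_action g w) = w"
proof (cases g)
  case (MCX c t)
  assume valid: "valid_gate (length w) g"
  \<comment> \<open>The target is not a control, so flipping it does not affect whether the gate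
    fires again.\<close>
  then have "w[t := b] ! q = w ! q" if "q \<in> dom c" for q b
    using that MCX by (intro nth_list_update_neq) auto
  with MCX valid show ?thesis by auto
qed auto

lemma fold_gate_action_rev:
  "\<forall>g\<in>set gs. valid_gate (length w) g \<Longrightarrow> fold gate_action (rev gs) (fold gate_action gs w) = w"
  by (induction gs arbitrary: w) (auto simp: gate_action_involutive)

lemma valid_circuit_conjugate:
  assumes "valid_circuit n C" "\<forall>g\<in>set L. valid_gate n g"
    "sorted_wrt (\<lambda>g h. disjnt (support g) (support h)) L"
  shows "valid_circuit n (L # C @ [rev L])"
proof -
  \<comment> \<open>Disjointness is symmetric, so a layer may be reversed.\<close>
  have "(\<lambda>g h. disjnt (support h) (support g)) = (\<lambda>g h. disjnt (support g) (support h))"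
    by (intro ext) (auto simp: disjnt_def)
  with assms show ?thesis by (auto simp: valid_circuit_def sorted_wrt_rev)
qed

lemma sorted_wrt_cx_layer:
  assumes "distinct (map fst ps @ map snd ps)"
  shows "sorted_wrt (\<lambda>g h. disjnt (support g) (support h)) (cx_layer ps)"
  using assms
proof (induction ps)
  case (Cons p ps)
  define A B where "A = map fst ps" and "B = map snd ps"
  have dist: "distinct (fst p # A @ snd p # B)" using Cons.prems by (simp add: A_def B_def)
  have "disjnt {fst p, snd p} {c, d}" if "(c, d) \<in> set ps" for c d
  proof -
    have "c \<in> set A" "d \<in> set B" using that by (force simp: A_def B_def)+
    with dist show ?thesis by (auto simp: disjnt_def)
  qed
  moreover have "sorted_wrt (\<lambda>g h. disjnt (support g) (support h)) (cx_layer ps)"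
    by (rule Cons.IH) (use dist in \<open>auto simp: A_def B_def\<close>)
  moreover have "cx_layer (p # ps) = CX (fst p) (snd p) # cx_layer ps" by (simp add: split_beta)
  ultimately show ?case by (auto simp del: list.map) blast+
qed simp

lemma exists_pairing:
  assumes "finite D"
  obtains ps where "distinct (map fst ps @ map snd ps)" "set (map fst ps @ map snd ps) \<subseteq> D"
    "length ps = card D div 2"
proof -
  obtain ds where ds: "set ds = D" "distinct ds" using finite_distinct_list[OF assms] by blast
  then have len: "length ds = card D" using distinct_card by fastforce
  let ?k = "card D div 2"
  \<comment> \<open>The first \<open>?k\<close> elements become controls and the next
    \<open>?k\<close> targets; if the cardinality is odd, one element stays unpaired.\<close>
  let ?ps = "zip (take ?k ds) (take ?k (drop ?k ds))"
  have k: "length (take ?k ds) = length (take ?k (drop ?k ds))" using len by simp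
  have "map fst ?ps @ map snd ?ps = take (?k + ?k) ds"
    using k by (simp add: take_add)
  then show ?thesis
    using ds len by (intro that[of ?ps]) (auto dest: in_set_takeD)
qed

section \<open>Base case: a single differing position\<close>

lemma transposition_circuit_single:
  assumes xy: "length x = n" "length y = n" and t: "diff_positions x y = {t}"
  shows "\<exists>c. valid_gate n (MCX c t) \<and>
    (\<forall>w\<in>bitstrings n. gate_action (MCX c t) w = transpose x y w)"
proof -
  \<comment> \<open>The pattern consists of the bits that \<open>x\<close> and \<open>y\<close>
    share, so exactly these two strings satisfy it, and flipping \<open>t\<close> exchanges
    them.\<close>
  let ?c = "\<lambda>q. if q < n \<and> q \<noteq> t then Some (x ! q) else None"
  have tn: "t < n" and xt: "x ! t \<noteq> y ! t"
    and other: "\<And>q. q < n \<Longrightarrow> q \<noteq> t \<Longrightarrow> x ! q = y ! q"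
    using t xy by (auto simp: diff_positions_def set_eq_iff)
  have dom: "dom ?c = {..<n} - {t}" by (auto split: if_splits)
  have flip_x: "flip t x = y"
  proof (rule nth_equalityI)
    fix i assume "i < length (flip t x)"
    then show "flip t x ! i = y ! i" using xy xt other[of i] by (cases "i = t") auto
  qed (use xy in simp)
  have flip_y: "flip t y = x"
    unfolding flip_x[symmetric] using tn xy by simp
  have "gate_action (MCX ?c t) w = transpose x y w" if "w \<in> bitstrings n" for w
  proof -
    have w: "length w = n" using that by (simp add: bitstrings_def)
    have "(\<forall>q\<in>dom ?c. ?c q = Some (w ! q)) \<longleftrightarrow> w = x \<or> w = y"
    proof
      assume "\<forall>q\<in>dom ?c. ?c q = Some (w ! q)"
      then have q: "w ! q = x ! q" if "q < n" "q \<noteq> t" for q using that unfolding dom by auto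
      show "w = x \<or> w = y"
      proof (cases "w ! t = x ! t")
        case True
        then have "w = x" by (intro nth_equalityI) (use q w xy in auto)
        then show ?thesis ..
      next
        case False
        have "w ! q = y ! q" if "q < n" for q
          using q[of q] other[of q] False xt that by (cases "q = t") auto
        then have "w = y" by (intro nth_equalityI) (use w xy in auto)
        then show ?thesis ..
      qed
    qed (unfold dom, use other in auto)
    then show ?thesis using flip_x flip_y by (auto simp: transpose_def)
  qed
  moreover have "valid_gate n (MCX ?c t)" unfolding valid_gate.simps dom using tn by simp
  ultimately show ?thesis by blast
qed

text \<open>The size bound depends on the number \<open>d\<close> of differing positions, not on
  \<open>m\<close>, so that it telescopes: a layer and its reverse cost
  \<open>2 * (d div 2)\<close>, and the inner circuit costs at most
  \<open>2 * (d - d div 2)\<close>.\<close>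

lemma exists_transposition_circuit:
  assumes "length x = n" "length y = n" "x \<noteq> y" "card (diff_positions x y) \<le> 2 ^ m"
  shows "\<exists>C. valid_circuit n C \<and> mcx_count C = 1 \<and>
    x_cx_count C \<le> 2 * card (diff_positions x y) \<and> x_cx_depth C \<le> 2 * m \<and>
    (\<forall>w\<in>bitstrings n. fold gate_action (concat C) w = transpose x y w)"
  using assms
proof (induction m arbitrary: x y)
  case 0
  have "diff_positions x y \<noteq> {}" "finite (diff_positions x y)"
    \<comment> \<open>Distinct strings of equal length differ somewhere, which together with the
      bound \<open>2 ^ 0\<close> forces exactly one position.\<close>
    using 0 by (auto simp: diff_positions_def list_eq_iff_nth_eq)
  then have "card (diff_positions x y) = 1"
    using 0 by (simp add: le_Suc_eq)
  then obtain t where "diff_positions x y = {t}" by (auto simp: card_1_singleton_iff)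
  from transposition_circuit_single[OF 0(1,2) this] obtain c where
    "valid_gate n (MCX c t)" "\<forall>w\<in>bitstrings n. gate_action (MCX c t) w = transpose x y w"
    by blast
  then show ?case
    by (intro exI[of _ "[[MCX c t]]"])
      (auto simp: valid_circuit_def mcx_count_def x_cx_count_def x_cx_depth_def)
next
  case (Suc m)
  let ?D = "diff_positions x y"
  have fin: "finite ?D" by (simp add: diff_positions_def)
  obtain ps where dist: "distinct (map fst ps @ map snd ps)"
    and sub: "set (map fst ps @ map snd ps) \<subseteq> ?D" and len: "length ps = card ?D div 2"
    using exists_pairing[OF fin] .
  let ?L = "cx_layer ps"
  define P where "P = fold gate_action ?L"
  have lenP: "length (P w) = length w" for w by (simp add: P_def)
  have valid: "\<forall>g\<in>set ?L. valid_gate n g"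
  proof
    fix g assume "g \<in> set ?L"
    then obtain a b where g: "g = CX a b" "(a, b) \<in> set ps" by auto
    then have "a \<in> set (map fst ps)" "b \<in> set (map snd ps)" by force+
    then show "valid_gate n g" using g(1) dist sub Suc.prems(1) by (auto simp: diff_positions_def)
  qed
  have PP: "fold gate_action (rev ?L) (P w) = w" if "length w = n" for w
    using fold_gate_action_rev[of ?L w] valid that by (simp add: P_def)
  have D': "diff_positions (P x) (P y) = ?D - set (map snd ps)"
    unfolding P_def by (rule diff_positions_cx_layer) (use Suc.prems dist sub in auto)
  have "card (set (map snd ps)) = card ?D div 2"
    using dist len distinct_card[of "map snd ps"] by simp
  then have card': "card (diff_positions (P x) (P y)) = card ?D - card ?D div 2"
    unfolding D' using sub by (subst card_Diff_subset) auto
  \<comment> \<open>The reversed layer is a left inverse of \<open>P\<close>, so \<open>P\<close> is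
    injective on strings of length \<open>n\<close>.\<close>
  have ne: "P x \<noteq> P y" using PP[of x] PP[of y] Suc.prems by metis
  \<comment> \<open>Half of \<open>d\<close>, rounded up, is at most \<open>2 ^ m\<close> whenever
    \<open>d\<close> is at most \<open>2 ^ Suc m\<close>.\<close>
  have "card (diff_positions (P x) (P y)) \<le> 2 ^ m" using Suc.prems(4) by (simp add: card')
  from Suc.IH[OF _ _ ne this] obtain C where C: "valid_circuit n C" "mcx_count C = 1"
    "x_cx_count C \<le> 2 * card (diff_positions (P x) (P y))" "x_cx_depth C \<le> 2 * m"
    and act: "\<And>w. w \<in> bitstrings n \<Longrightarrow> fold gate_action (concat C) w = transpose (P x) (P y) w"
    using Suc.prems by (auto simp: lenP)
  let ?C = "?L # C @ [rev ?L]"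
  have "valid_circuit n ?C"
    using C(1) valid sorted_wrt_cx_layer[OF dist] by (rule valid_circuit_conjugate)
  moreover have no_mcx: "filter is_MCX ?L = []" "filter (\<lambda>g. is_X g \<or> is_CX g) ?L = ?L"
    by (auto simp: filter_empty_conv intro!: filter_True)
  have "mcx_count ?C = 1"
    using C(2) no_mcx by (simp add: mcx_count_def flip: rev_filter)
  moreover have "x_cx_count ?C = 2 * length ps + x_cx_count C"
    using no_mcx by (simp add: x_cx_count_def flip: rev_filter)
  then have "x_cx_count ?C \<le> 2 * card ?D" using C(3) len card' by simp
  moreover have "x_cx_depth ?C \<le> 2 * Suc m" using C(4) by (simp add: x_cx_depth_def)
  moreover have "fold gate_action (concat ?C) w = transpose x y w" if "w \<in> bitstrings n" for w
  proof -
    have w: "length w = n" using that by (simp add: bitstrings_def)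
    have "fold gate_action (concat ?C) w = fold gate_action (rev ?L) (transpose (P x) (P y) (P w))"
      using w by (simp add: act bitstrings_def lenP flip: P_def)
    \<comment> \<open>Conjugating a transposition by an injective map relabels its two points:
      \<open>P x\<close> and \<open>P y\<close> are pulled back to \<open>x\<close> and
      \<open>y\<close>.\<close>
    also have "\<dots> = transpose x y w"
    proof -
      have inj: "P w = P z \<longleftrightarrow> w = z" if "length z = n" for z
        using PP[OF w] PP[OF that] by metis
      show ?thesis
        using PP[OF w] PP[OF Suc.prems(1)] PP[OF Suc.prems(2)]
        by (simp add: transpose_def inj Suc.prems(1,2))
    qed
    finally show ?thesis .
  qed
  ultimately show ?case by blast
qed

section \<open>Asymptotic bounds and conclusion\<close>

lemma ceiling_log_in_bigo:
  "(\<lambda>n. real (2 * nat \<lceil>log 2 (real n)\<rceil>)) \<in> O(\<lambda>n. log 2 (real n))"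
\<comment> \<open>For \<open>n\<close> at least 2 the logarithm is at least 1, so rounding up at
  most doubles it; the leading factor 2 gives 4.\<close>
proof (rule bigoI[of _ 4])
  show "\<forall>\<^sub>F n in sequentially. norm (real (2 * nat \<lceil>log 2 (real n)\<rceil>)) \<le> 4 * norm (log 2 (real n))"
    using eventually_ge_at_top[of 2]
  proof eventually_elim
    case (elim n)
    then have "1 \<le> log 2 (real n)" by simp
    then show ?case by simp linarith
  qed
qed

theorem mainTheorem5:
  shows "\<exists>size_bound depth_bound :: nat \<Rightarrow> nat.
    (\<lambda>n. real (size_bound n)) \<in> O(\<lambda>n. real n) \<and>
    (\<lambda>n. real (depth_bound n)) \<in> O(\<lambda>n. log 2 (real n)) \<and>
    (\<forall>n\<ge>2. \<forall>x\<in>bitstrings n. \<forall>y\<in>bitstrings n. x \<noteq> y \<longrightarrow>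
      (\<exists>C :: circuit. valid_circuit n C \<and>
         mcx_count C = 1 \<and>
         x_cx_count C \<le> size_bound n \<and>
         x_cx_depth C \<le> depth_bound n \<and>
         circuit_mat n C = transposition_gate n x y))"
proof (rule exI[of _ "\<lambda>n. 2 * n"], rule exI[of _ "\<lambda>n. 2 * nat \<lceil>log 2 (real n)\<rceil>"],
    intro conjI allI impI ballI)
  show "(\<lambda>n. real (2 * n)) \<in> O(\<lambda>n. real n)" by simp
  show "(\<lambda>n. real (2 * nat \<lceil>log 2 (real n)\<rceil>)) \<in> O(\<lambda>n. log 2 (real n))"
    by (rule ceiling_log_in_bigo)
next
  fix n :: nat and x y
  assume n: "2 \<le> n" and x: "x \<in> bitstrings n" and y: "y \<in> bitstrings n" and ne: "x \<noteq> y"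
  \<comment> \<open>Rounding the logarithm up ensures \<open>n\<close> \<le> \<open>2 ^ m\<close>,
    so \<open>m\<close> halvings suffice for any set of at most \<open>n\<close> differing
    positions.\<close>
  define m where "m = nat \<lceil>log 2 (real n)\<rceil>"
  have len: "length x = n" "length y = n" using x y by (auto simp: bitstrings_def)
  have card: "card (diff_positions x y) \<le> n"
    using card_mono[of "{..<n}" "diff_positions x y"] len by (auto simp: diff_positions_def)
  have "log 2 (real n) \<le> real m" unfolding m_def by linarith
  then have "2 powr log 2 (real n) \<le> 2 powr real m" by simp
  then have "real n \<le> real (2 ^ m)" using n by (simp add: powr_realpow)
  then have "n \<le> 2 ^ m" by (simp only: of_nat_le_iff)
  with card have "card (diff_positions x y) \<le> 2 ^ m" by linarith
  from exists_transposition_circuit[OF len ne this] obtain C where C: "valid_circuit n C"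
    "mcx_count C = 1" "x_cx_count C \<le> 2 * card (diff_positions x y)" "x_cx_depth C \<le> 2 * m"
    and act: "\<And>w. w \<in> bitstrings n \<Longrightarrow> fold gate_action (concat C) w = transpose x y w"
    by blast
  have "x_cx_count C \<le> 2 * n" using C(3) card by linarith
  with C circuit_mat_eq_transposition_gate[OF x y ne act]
  show "\<exists>C. valid_circuit n C \<and> mcx_count C = 1 \<and> x_cx_count C \<le> 2 * n \<and>
      x_cx_depth C \<le> 2 * nat \<lceil>log 2 (real n)\<rceil> \<and> circuit_mat n C = transposition_gate n x y"
    unfolding m_def by blast
qed

end
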